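(* Let $p$ be an even natural number (with $p\ge 2$) and let $\mu^{(p)}$ be the probability measure on the unit circle associated with the pair $\{\{c_n\}_{n=1}^{\infty},\{d_n\}_{n=1}^{\infty}\}$, where $\{c_n\}_{n=1}^\infty$ is a real sequence and $\{d_n\}_{n=1}^\infty$ is a positive chain sequence with minimal parameter sequence $\{m_n\}_{n=0}^\infty$. Let $\{\alpha_n\}_{n=0}^\infty$ be the sequence of Verblunsky coefficients of $\mu^{(p)}$. Then the following statements are equivalent: (i) the sequences $\{c_n\}_{n=1}^{\infty}$ and $\{m_n\}_{n=1}^{\infty}$ are $p$-periodic with $c_{2n}=-c_{2n-1}$ for $n\ge1$; (ii) the sequence $\{\alpha_n\}_{n=0}^{\infty}$ is $p$-periodic and, in addition, for each $k\in\{0,1,\ldots,\frac{p-2}{2}\}$, the straight line connecting $\alpha_{2k}$ to $1$ and the straight line connecting $\alpha_{2k+1}$ to $-1$ (in the complex plane) are parallel.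
   Context: $\mathbb{T}=\{z\in\mathbb{C}:|z|=1\}$. A sequence $\{a_n\}$ is $p$-periodic if $a_{n+p}=a_n$ for all indices $n$ of the sequence. Two lines are parallel if they have the same direction; coinciding lines count as parallel. A real sequence $\{d_n\}_{n=1}^\infty$ is a positive chain sequence if there is a sequence $\{g_n\}_{n=0}^\infty$ (a parameter sequence) with $0\le g_0<1$, $0<g_n<1$ for $n\ge1$, and $d_n=(1-g_{n-1})g_n$ for $n\ge1$. The minimal parameter sequence $\{m_n\}_{n=0}^\infty$ is the one with $m_0=0$. For a nontrivial probability measure $\mu$ on $\mathbb{T}$ (infinite support) with monic orthogonal polynomials $\phi_n$, the Verblunsky coefficients are $\alpha_{n-1}=-\overline{\phi_n(0)}$, $n\ge1$; every sequence $\{\alpha_n\}_{n\ge0}$ with $|\alpha_n|<1$ is the Verblunsky sequence of exactly one nontrivial probability measure on $\mathbb{T}$. The measure associated with a pair $\{\{c_n\}_{n=1}^\infty,\{d_n\}_{n=1}^\infty\}$, where $\{c_n\}$ is real and $\{d_n\}$ is a positive chain sequence with minimal parameter sequence $\{m_n\}$, is the unique nontrivial probability measure on $\mathbb{T}$ with Verblunsky coefficients $$\alpha_{n-1}=\overline{\tau}_{n-1}\,\frac{1-2m_n-ic_n}{1-ic_n},\quad n\ge1,\qquad \tau_0=1,\quad \tau_n=\prod_{k=1}^n\frac{1-ic_k}{1+ic_k}.$$ *)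

theory Defs
  imports "HOL-Probability.Probability" "HOL-Computational_Algebra.Polynomial"
begin

abbreviation unit_circle :: "complex set" where
  "unit_circle \<equiv> sphere 0 1"

definition periodic_from :: "nat \<Rightarrow> nat \<Rightarrow> (nat \<Rightarrow> 'a) \<Rightarrow> bool" where
  "periodic_from s p a \<longleftrightarrow> (\<forall>n\<ge>s. a (n + p) = a n)"


text \<open>Sequences indexed by \<open>n \<ge> 1\<close>, such as \<open>d\<close> and \<open>c\<close> below, are
  functions on \<^typ>\<open>nat\<close> whose value at \<open>0\<close> is irrelevant. Parameter sequences start at index \<open>0\<close>.\<close>

definition parameter_sequence :: "(nat \<Rightarrow> real) \<Rightarrow> (nat \<Rightarrow> real) \<Rightarrow> bool" where
  "parameter_sequence d g \<longleftrightarrow>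
     0 \<le> g 0 \<and> g 0 < 1 \<and>
     (\<forall>n\<ge>1. 0 < g n \<and> g n < 1) \<and>
     (\<forall>n\<ge>1. d n = (1 - g (n - 1)) * g n)"

definition positive_chain_sequence :: "(nat \<Rightarrow> real) \<Rightarrow> bool" where
  "positive_chain_sequence d \<longleftrightarrow> (\<exists>g. parameter_sequence d g)"

definition minimal_parameter_sequence :: "(nat \<Rightarrow> real) \<Rightarrow> (nat \<Rightarrow> real) \<Rightarrow> bool" where
  "minimal_parameter_sequence d m \<longleftrightarrow> parameter_sequence d m \<and> m 0 = 0"


definition circle_support :: "complex measure \<Rightarrow> complex set" where
  "circle_support \<mu> =
     {z \<in> unit_circle. \<forall>U. open U \<longrightarrow> z \<in> U \<longrightarrow> emeasure \<mu> (U \<inter> unit_circle) > 0}"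

definition nontrivial_circle_prob :: "complex measure \<Rightarrow> bool" where
  "nontrivial_circle_prob \<mu> \<longleftrightarrow>
     prob_space \<mu> \<and> sets \<mu> = sets (restrict_space borel unit_circle) \<and>
     infinite (circle_support \<mu>)"

text \<open>For a nontrivial probability measure the monic orthogonal polynomial of each degree exists
  and is unique, so the definite description is meaningful.\<close>

definition monic_OP :: "complex measure \<Rightarrow> nat \<Rightarrow> complex poly" where
  "monic_OP \<mu> n = (THE P. degree P = n \<and> lead_coeff P = 1 \<and>
     (\<forall>Q. degree Q < n \<longrightarrow> (\<integral>z. poly P z * cnj (poly Q z) \<partial>\<mu>) = 0))"

definition verblunsky :: "complex measure \<Rightarrow> nat \<Rightarrow> complex" where
  "verblunsky \<mu> n = - cnj (poly (monic_OP \<mu> (Suc n)) 0)"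


definition tau :: "(nat \<Rightarrow> real) \<Rightarrow> nat \<Rightarrow> complex" where
  "tau c n = (\<Prod>k=1..n. (1 - \<i> * of_real (c k)) / (1 + \<i> * of_real (c k)))"

text \<open>The measure associated with a pair \<open>(c, d)\<close> is rendered as a relation. By Verblunsky's theorem
  exactly one \<open>\<mu>\<close> satisfies it when \<open>d\<close> is a positive chain sequence; the quantified \<open>m\<close> is
  determined by \<open>d\<close>.\<close>

definition associated_measure ::
  "(nat \<Rightarrow> real) \<Rightarrow> (nat \<Rightarrow> real) \<Rightarrow> complex measure \<Rightarrow> bool" where
  "associated_measure c d \<mu> \<longleftrightarrow>
     nontrivial_circle_prob \<mu> \<and>
     (\<exists>m. minimal_parameter_sequence d m \<and>
       (\<forall>n\<ge>1. verblunsky \<mu> (n - 1) =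
          cnj (tau c (n - 1)) *
          ((1 - 2 * of_real (m n) - \<i> * of_real (c n)) / (1 - \<i> * of_real (c n)))))"


definition line_through :: "complex \<Rightarrow> complex \<Rightarrow> complex set" where
  "line_through a b = affine hull {a, b}"

end

theory Submission
  imports Defs
begin

text \<open>
  The Verblunsky coefficients of the measure are explicit in terms of \<open>c\<close> and \<open>m\<close>, so the
  theorem is a statement about the geometry of these complex numbers. Put \<open>w\<^sub>n = (1 - 2 m\<^sub>n - \<i> c\<^sub>n) / (1 - \<i> c\<^sub>n)\<close>, so that
  \<open>1 - w\<^sub>n = 2 m\<^sub>n / (1 - \<i> c\<^sub>n)\<close> is a positive multiple of \<open>1 + \<i> c\<^sub>n\<close>.

  The antisymmetry \<open>c\<^sub>2\<^sub>n = -c\<^sub>2\<^sub>n\<^sub>-\<^sub>1\<close> makes the factors of \<open>\<tau>\<close> cancel in pairs, hence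
  \<open>\<tau>\<^sub>2\<^sub>k = 1\<close>. As long as \<open>\<tau>\<^sub>2\<^sub>k = 1\<close>, the line from \<open>\<alpha>\<^sub>2\<^sub>k = w\<^sub>2\<^sub>k\<^sub>+\<^sub>1\<close> to \<open>1\<close> has direction
  \<open>1 / (1 - \<i> c\<^sub>2\<^sub>k\<^sub>+\<^sub>1)\<close>, and one computes
  \<open>(1 + \<alpha>\<^sub>2\<^sub>k\<^sub>+\<^sub>1) (1 - \<i> c\<^sub>2\<^sub>k\<^sub>+\<^sub>1) = 2 - 2 m\<^sub>2\<^sub>k\<^sub>+\<^sub>2 (1 + \<i> c\<^sub>2\<^sub>k\<^sub>+\<^sub>1) / (1 - \<i> c\<^sub>2\<^sub>k\<^sub>+\<^sub>2)\<close>,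
  which is real exactly when \<open>c\<^sub>2\<^sub>k\<^sub>+\<^sub>2 = -c\<^sub>2\<^sub>k\<^sub>+\<^sub>1\<close>, and is then
  \<open>2 (1 - m\<^sub>2\<^sub>k\<^sub>+\<^sub>2) \<noteq> 0\<close>. So parallelism at \<open>k\<close> is the same as
  antisymmetry at \<open>k\<close>, provided antisymmetry holds at all smaller indices
  (\<open>parallel_iff_antisymmetric\<close>), and induction turns this into an equivalence of the two
  conditions for all \<open>k\<close>. Since \<open>p\<close> is even, periodicity of \<open>\<alpha>\<close> spreads parallelism from one
  period to all \<open>k\<close>.

  Once antisymmetry is known, \<open>1 - \<alpha>\<^sub>2\<^sub>k\<close> and \<open>1 + \<alpha>\<^sub>2\<^sub>k\<^sub>+\<^sub>1\<close> are the positive multiples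
  \<open>2 m\<^sub>2\<^sub>k\<^sub>+\<^sub>1\<close> and \<open>2 (1 - m\<^sub>2\<^sub>k\<^sub>+\<^sub>2)\<close> of \<open>1 / (1 - \<i> c\<^sub>2\<^sub>k\<^sub>+\<^sub>1)\<close>, so \<open>\<alpha>\<close> and the pair \<open>(c, m)\<close>
  determine each other block by block and are periodic together (\<open>periodic_iff_periodic\<close>).
\<close>

section \<open>Parallel lines in the complex plane\<close>

lemma line_through_eq_range: "line_through a b = range (\<lambda>t::real. a + of_real t * (b - a))"
proof -
  have "line_through a b = {(1 - v) *\<^sub>R a + v *\<^sub>R b |v. True}"
  proof -
    have "u + v = 1 \<longleftrightarrow> u = 1 - v" for u v :: real by auto
    then show ?thesis unfolding line_through_def affine_hull_2 by auto
  qed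
  then show ?thesis
    by (auto simp: image_def scaleR_conv_of_real algebra_simps)
qed

text \<open>Allowing any nonzero factor makes the criterion valid for degenerate lines too: a point is
  parallel to a point, never to a proper line.\<close>

lemma affine_parallel_line_through_iff:
  "affine_parallel (line_through a b) (line_through a' b') \<longleftrightarrow>
     (\<exists>t::real. t \<noteq> 0 \<and> b' - a' = of_real t * (b - a))"
proof
  assume "affine_parallel (line_through a b) (line_through a' b')"
  then obtain s where s: "line_through a' b' = (\<lambda>x. s + x) ` line_through a b"
    unfolding affine_parallel_def by blast
  have fwd: "\<exists>t::real. a' + of_real u * (b' - a') = s + (a + of_real t * (b - a))" for u :: real
  proof -
    have "a' + of_real u * (b' - a') \<in> line_through a' b'"
      by (auto simp: line_through_eq_range)
    then show ?thesis unfolding s by (auto simp: line_through_eq_range)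
  qed
  have bwd: "\<exists>t::real. s + (a + of_real u * (b - a)) = a' + of_real t * (b' - a')" for u :: real
  proof -
    have "s + (a + of_real u * (b - a)) \<in> line_through a' b'"
      unfolding s by (auto simp: line_through_eq_range)
    then show ?thesis by (auto simp: line_through_eq_range)
  qed
  obtain t0 t1 :: real where
    t: "a' = s + (a + of_real t0 * (b - a))" "b' = s + (a + of_real t1 * (b - a))"
    using fwd[of 0] fwd[of 1] by auto
  obtain u0 u1 :: real where
    u: "s + a = a' + of_real u0 * (b' - a')" "s + b = a' + of_real u1 * (b' - a')"
    using bwd[of 0] bwd[of 1] by auto
  have 1: "b' - a' = of_real (t1 - t0) * (b - a)"
    unfolding t by (simp add: algebra_simps)
  have "b - a = (s + b) - (s + a)" by simp
  also have "\<dots> = of_real (u1 - u0) * (b' - a')"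
    unfolding u by (simp add: algebra_simps)
  finally have 2: "b - a = of_real (u1 - u0) * (b' - a')" .
  show "\<exists>t::real. t \<noteq> 0 \<and> b' - a' = of_real t * (b - a)"
  proof (cases "b = a")
    case True
    then show ?thesis using 1 by (intro exI[of _ 1]) simp
  next
    case False
    then have "b' - a' \<noteq> 0" using 2 by auto
    then show ?thesis using 1 by (intro exI[of _ "t1 - t0"]) auto
  qed
next
  assume "\<exists>t::real. t \<noteq> 0 \<and> b' - a' = of_real t * (b - a)"
  then obtain t :: real where t: "t \<noteq> 0" "b' - a' = of_real t * (b - a)" by blast
  have "surj ((*) t)" using t(1) by (intro surjI[of _ "\<lambda>x. x / t"]) simp
  then have "line_through a' b' = (\<lambda>u::real. a' + of_real u * (b - a)) ` range ((*) t)"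
    unfolding line_through_eq_range t(2) image_image by (simp only: of_real_mult mult_ac)
  also have "\<dots> = (\<lambda>u::real. a' + of_real u * (b - a)) ` UNIV"
    using \<open>surj ((*) t)\<close> by simp
  also have "\<dots> = (\<lambda>x. (a' - a) + x) ` line_through a b"
    by (simp add: line_through_eq_range image_image)
  finally show "affine_parallel (line_through a b) (line_through a' b')"
    unfolding affine_parallel_def by blast
qed

section \<open>Chain sequences and the factors of the Verblunsky coefficients\<close>

text \<open>The definition of the associated measure quantifies over its own minimal parameter sequence;
  the recursion \<open>m\<^sub>n = d\<^sub>n / (1 - m\<^sub>n\<^sub>-\<^sub>1)\<close> from \<open>m\<^sub>0 = 0\<close> identifies it with any other.\<close>

lemma minimal_parameter_sequence_unique:
  assumes "minimal_parameter_sequence d m" and "minimal_parameter_sequence d m'"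
  shows "m n = m' n"
proof (induction n)
  case 0
  then show ?case using assms by (simp add: minimal_parameter_sequence_def)
next
  case (Suc n)
  have rec: "d (Suc n) = (1 - g n) * g (Suc n)" "g n < 1"
    if "minimal_parameter_sequence d g" for g
  proof -
    have g: "parameter_sequence d g"
      using that by (simp add: minimal_parameter_sequence_def)
    then have "\<forall>n\<ge>1. d n = (1 - g (n - 1)) * g n"
      unfolding parameter_sequence_def by blast
    then show "d (Suc n) = (1 - g n) * g (Suc n)" by force
    show "g n < 1"
      using g unfolding parameter_sequence_def by (cases n) auto
  qed
  show ?case using rec[OF assms(1)] rec[OF assms(2)] Suc.IH by simp
qed

lemma one_minus_i_times_real_nonzero: "1 - \<i> * of_real x \<noteq> 0" "1 + \<i> * of_real x \<noteq> 0"
  by (simp_all add: complex_eq_iff)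

text \<open>The points \<open>1 / (1 - \<i> x)\<close> all lie on one circle through the origin, so every line
  through the origin other than the imaginary axis meets it in just one further point.\<close>

lemma real_multiple_inverse_eq_iff:
  fixes s t x y :: real
  assumes "s \<noteq> 0"
  shows "of_real s / (1 - \<i> * of_real x) = of_real t / (1 - \<i> * of_real y) \<longleftrightarrow> s = t \<and> x = y"
  unfolding frac_eq_eq[OF one_minus_i_times_real_nonzero(1) one_minus_i_times_real_nonzero(1)]
  using assms by (auto simp: complex_eq_iff)

lemma tau_even_eq_1:
  assumes "\<And>j. j < k \<Longrightarrow> c (2 * j + 2) = - c (2 * j + 1)"
  shows "tau c (2 * k) = 1"
  using assms
proof (induction k)
  case 0
  then show ?case by (simp add: tau_def)
next
  case (Suc k)
  let ?x = "c (2 * k + 1)"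
  have "tau c (2 * Suc k) = tau c (2 * k) * ((1 - \<i> * of_real ?x) / (1 + \<i> * of_real ?x))
      * ((1 - \<i> * of_real (c (2 * k + 2))) / (1 + \<i> * of_real (c (2 * k + 2))))"
    by (simp add: tau_def)
  also have "tau c (2 * k) = 1" using Suc by simp
  also have "c (2 * k + 2) = - ?x" using Suc.prems[of k] by simp
  finally show ?case using one_minus_i_times_real_nonzero[of ?x] by simp
qed

section \<open>Parallelism and antisymmetry\<close>

locale verblunsky_pair =
  fixes c m :: "nat \<Rightarrow> real" and \<alpha> :: "nat \<Rightarrow> complex"
  assumes m_bounds: "n \<ge> 1 \<Longrightarrow> 0 < m n \<and> m n < 1"
    and \<alpha>_eq: "\<alpha> n = cnj (tau c n) *
          ((1 - 2 * of_real (m (Suc n)) - \<i> * of_real (c (Suc n))) / (1 - \<i> * of_real (c (Suc n))))"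
begin

lemma one_minus_\<alpha>_even:
  assumes "tau c (2 * k) = 1"
  shows "1 - \<alpha> (2 * k) = of_real (2 * m (2 * k + 1)) / (1 - \<i> * of_real (c (2 * k + 1)))"
proof -
  define u where "u = 1 - \<i> * complex_of_real (c (2 * k + 1))"
  have "u \<noteq> 0" unfolding u_def by (rule one_minus_i_times_real_nonzero)
  moreover have "\<alpha> (2 * k) = (u - of_real (2 * m (2 * k + 1))) / u"
    unfolding \<alpha>_eq assms u_def by (simp add: diff_diff_eq add.commute)
  ultimately show ?thesis unfolding u_def[symmetric] by (simp add: diff_divide_distrib)
qed

lemma one_plus_\<alpha>_odd:
  assumes "tau c (2 * k) = 1"
  shows "1 + \<alpha> (2 * k + 1) =
    (2 - of_real (2 * m (2 * k + 2)) *
       ((1 + \<i> * of_real (c (2 * k + 1))) / (1 - \<i> * of_real (c (2 * k + 2)))))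
      / (1 - \<i> * of_real (c (2 * k + 1)))"
proof -
  \<comment> \<open>Conjugation swaps \<open>u\<close> and \<open>v\<close>, so the conjugated \<open>\<tau>\<close> is \<open>v / u\<close>; adding \<open>1 = u / u\<close>
    then brings in only \<open>u + v = 2\<close>.\<close>
  define u v w where "u = 1 - \<i> * complex_of_real (c (2 * k + 1))"
    and "v = 1 + \<i> * complex_of_real (c (2 * k + 1))"
    and "w = 1 - \<i> * complex_of_real (c (2 * k + 2))"
  have nz: "u \<noteq> 0" "w \<noteq> 0"
    unfolding u_def w_def by (rule one_minus_i_times_real_nonzero)+
  have "u + v = 2" by (simp add: u_def v_def)
  have "tau c (2 * k + 1) = u / v"
    using assms by (simp add: tau_def u_def v_def)
  moreover have "cnj u = v" "cnj v = u" by (simp_all add: u_def v_def)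
  ultimately have "\<alpha> (2 * k + 1) = v / u * ((w - of_real (2 * m (2 * k + 2))) / w)"
    by (simp add: \<alpha>_eq w_def algebra_simps)
  also have "\<dots> = (v - of_real (2 * m (2 * k + 2)) * (v / w)) / u"
    using nz by (simp add: field_simps)
  finally have "1 + \<alpha> (2 * k + 1) = ((u + v) - of_real (2 * m (2 * k + 2)) * (v / w)) / u"
    using nz by (simp add: field_simps)
  then show ?thesis
    unfolding \<open>u + v = 2\<close> unfolding u_def v_def w_def .
qed

lemma one_plus_\<alpha>_odd_antisymmetric:
  assumes "tau c (2 * k) = 1" and "c (2 * k + 2) = - c (2 * k + 1)"
  shows "1 + \<alpha> (2 * k + 1) =
    of_real (2 * (1 - m (2 * k + 2))) / (1 - \<i> * of_real (c (2 * k + 1)))"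
proof -
  have "(1 + \<i> * complex_of_real (c (2 * k + 1))) / (1 - \<i> * of_real (c (2 * k + 2))) = 1"
    using one_minus_i_times_real_nonzero(2)[of "c (2 * k + 1)"] unfolding assms(2) by simp
  then show ?thesis
    unfolding one_plus_\<alpha>_odd[OF assms(1)] by simp
qed

text \<open>Multiplying both directions by \<open>1 - \<i> c\<^sub>2\<^sub>k\<^sub>+\<^sub>1\<close> makes the first one real. The second one
  becomes real only if \<open>m\<^sub>2\<^sub>k\<^sub>+\<^sub>2 (1 + \<i> c\<^sub>2\<^sub>k\<^sub>+\<^sub>1)\<close> is a real multiple of \<open>1 - \<i> c\<^sub>2\<^sub>k\<^sub>+\<^sub>2\<close>, and
  \<open>m\<^sub>2\<^sub>k\<^sub>+\<^sub>2 > 0\<close> lets the imaginary parts be compared. Conversely \<open>m\<^sub>2\<^sub>k\<^sub>+\<^sub>2 < 1\<close> keeps the second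
  line from degenerating to a point.\<close>

lemma parallel_iff_antisymmetric:
  assumes "tau c (2 * k) = 1"
  shows "affine_parallel (line_through (\<alpha> (2 * k)) 1) (line_through (\<alpha> (2 * k + 1)) (-1))
    \<longleftrightarrow> c (2 * k + 2) = - c (2 * k + 1)"
proof -
  define x y s r where "x = c (2 * k + 1)" and "y = c (2 * k + 2)"
    and "s = m (2 * k + 1)" and "r = m (2 * k + 2)"
  have bounds: "0 < s" "0 < r" "r < 1"
    using m_bounds[of "2 * k + 1"] m_bounds[of "2 * k + 2"] by (auto simp: s_def r_def)
  note nz = one_minus_i_times_real_nonzero[of x] one_minus_i_times_real_nonzero[of y]
  have even: "1 - \<alpha> (2 * k) = of_real (2 * s) / (1 - \<i> * of_real x)"
    using one_minus_\<alpha>_even[OF assms] by (simp add: x_def s_def)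
  show ?thesis
  proof
    assume "c (2 * k + 2) = - c (2 * k + 1)"
    then have "1 + \<alpha> (2 * k + 1) = of_real (2 * (1 - r)) / (1 - \<i> * of_real x)"
      using one_plus_\<alpha>_odd_antisymmetric[OF assms] by (simp add: x_def r_def)
    moreover have "of_real (- (1 - r) / s) * (1 - \<alpha> (2 * k))
        = - (of_real (2 * (1 - r)) / (1 - \<i> * of_real x))"
      unfolding even minus_divide_left using bounds by simp
    ultimately have "- 1 - \<alpha> (2 * k + 1) = of_real (- (1 - r) / s) * (1 - \<alpha> (2 * k))"
      by (metis minus_add_distrib uminus_add_conv_diff add_uminus_conv_diff)
    then show "affine_parallel (line_through (\<alpha> (2 * k)) 1) (line_through (\<alpha> (2 * k + 1)) (-1))"
      unfolding affine_parallel_line_through_iff using bounds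
      by (intro exI[of _ "- (1 - r) / s"]) auto
  next
    assume "affine_parallel (line_through (\<alpha> (2 * k)) 1) (line_through (\<alpha> (2 * k + 1)) (-1))"
    then obtain t :: real where "- 1 - \<alpha> (2 * k + 1) = of_real t * (1 - \<alpha> (2 * k))"
      unfolding affine_parallel_line_through_iff by blast
    then have "- (1 + \<alpha> (2 * k + 1)) = of_real (2 * s * t) / (1 - \<i> * of_real x)"
      unfolding even by (simp add: mult_ac)
    then have "1 + \<alpha> (2 * k + 1) = of_real (- (2 * s * t)) / (1 - \<i> * of_real x)"
      by (metis add.inverse_inverse minus_divide_left of_real_minus)
    then have "2 - of_real (2 * r) * ((1 + \<i> * of_real x) / (1 - \<i> * of_real y))
        = of_real (- (2 * s * t))"
      using one_plus_\<alpha>_odd[OF assms] nz(1)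
      unfolding x_def[symmetric] y_def[symmetric] r_def[symmetric]
      by (metis divide_cancel_right)
    then have "of_real r * ((1 + \<i> * of_real x) / (1 - \<i> * of_real y))
        = complex_of_real (1 + s * t)"
      unfolding of_real_add of_real_mult of_real_minus of_real_1 of_real_numeral by algebra
    then have eq: "of_real r * (1 + \<i> * of_real x) = of_real (1 + s * t) * (1 - \<i> * of_real y)"
      using nz(3) by (metis nonzero_divide_eq_eq times_divide_eq_right)
    \<comment> \<open>The real parts identify the real factor as \<open>r\<close>, and then the imaginary parts agree.\<close>
    have "r = 1 + s * t" using arg_cong[OF eq, of Re] by simp
    moreover have "r * x = - ((1 + s * t) * y)" using arg_cong[OF eq, of Im] by simp
    ultimately have "r * x = r * (- y)" by (metis mult_minus_right)
    then have "x = - y" using bounds by (simp only: mult_cancel_left) auto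
    then show "c (2 * k + 2) = - c (2 * k + 1)"
      unfolding x_def y_def by linarith
  qed
qed

text \<open>Knowing the direction of the line at \<open>k\<close> requires \<open>\<tau>\<^sub>2\<^sub>k = 1\<close>, that is, antisymmetry
  below \<open>k\<close>; therefore the equivalence holds for all \<open>k\<close> jointly, by strong induction.\<close>

lemma all_parallel_iff_all_antisymmetric:
  "(\<forall>k. affine_parallel (line_through (\<alpha> (2 * k)) 1) (line_through (\<alpha> (2 * k + 1)) (-1)))
    \<longleftrightarrow> (\<forall>k. c (2 * k + 2) = - c (2 * k + 1))"
proof
  assume par: "\<forall>k. affine_parallel (line_through (\<alpha> (2 * k)) 1) (line_through (\<alpha> (2 * k + 1)) (-1))"
  have "c (2 * k + 2) = - c (2 * k + 1)" for k
  proof (induction k rule: less_induct)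
    case (less k)
    then show ?case using parallel_iff_antisymmetric[OF tau_even_eq_1] par by blast
  qed
  then show "\<forall>k. c (2 * k + 2) = - c (2 * k + 1)" by blast
next
  assume "\<forall>k. c (2 * k + 2) = - c (2 * k + 1)"
  then show "\<forall>k. affine_parallel (line_through (\<alpha> (2 * k)) 1) (line_through (\<alpha> (2 * k + 1)) (-1))"
    using parallel_iff_antisymmetric[OF tau_even_eq_1] by blast
qed

section \<open>Periodicity\<close>

text \<open>With antisymmetry, the coefficients \<open>\<alpha>\<^sub>2\<^sub>k, \<alpha>\<^sub>2\<^sub>k\<^sub>+\<^sub>1\<close> encode exactly the entries of \<open>c\<close> and
  \<open>m\<close> at \<open>2k+1\<close> and \<open>2k+2\<close>: no later \<open>\<tau>\<close> remembers an earlier block.\<close>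

lemma block_eq_iff:
  assumes anti: "\<And>k. c (2 * k + 2) = - c (2 * k + 1)"
  shows "\<alpha> (2 * k) = \<alpha> (2 * j) \<and> \<alpha> (2 * k + 1) = \<alpha> (2 * j + 1) \<longleftrightarrow>
    c (2 * k + 1) = c (2 * j + 1) \<and> m (2 * k + 1) = m (2 * j + 1) \<and> m (2 * k + 2) = m (2 * j + 2)"
proof -
  have tau: "tau c (2 * i) = 1" for i
    using tau_even_eq_1 anti by blast
  have "\<alpha> (2 * k) = \<alpha> (2 * j) \<longleftrightarrow> 1 - \<alpha> (2 * k) = 1 - \<alpha> (2 * j)" by simp
  also have "\<dots> \<longleftrightarrow> m (2 * k + 1) = m (2 * j + 1) \<and> c (2 * k + 1) = c (2 * j + 1)"
    unfolding one_minus_\<alpha>_even[OF tau] using m_bounds[of "2 * k + 1"]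
    by (subst real_multiple_inverse_eq_iff) auto
  finally have even: "\<alpha> (2 * k) = \<alpha> (2 * j) \<longleftrightarrow>
    m (2 * k + 1) = m (2 * j + 1) \<and> c (2 * k + 1) = c (2 * j + 1)" .
  have "\<alpha> (2 * k + 1) = \<alpha> (2 * j + 1) \<longleftrightarrow> 1 + \<alpha> (2 * k + 1) = 1 + \<alpha> (2 * j + 1)" by simp
  also have "\<dots> \<longleftrightarrow> m (2 * k + 2) = m (2 * j + 2) \<and> c (2 * k + 1) = c (2 * j + 1)"
    unfolding one_plus_\<alpha>_odd_antisymmetric[OF tau anti] using m_bounds[of "2 * k + 2"]
    by (subst real_multiple_inverse_eq_iff) auto
  finally show ?thesis using even by blast
qed

end

lemma all_nat_parity: "(\<forall>n. P n) \<longleftrightarrow> (\<forall>k. P (2 * k) \<and> P (2 * k + 1))" for P :: "nat \<Rightarrow> bool"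
proof
  assume P: "\<forall>k. P (2 * k) \<and> P (2 * k + 1)"
  show "\<forall>n. P n"
  proof
    fix n show "P n" using P by (cases "even n") (auto elim!: evenE oddE)
  qed
qed blast

lemma periodic_from_0_even_iff:
  "periodic_from 0 (2 * q) a \<longleftrightarrow>
    (\<forall>k. a (2 * (k + q)) = a (2 * k) \<and> a (2 * (k + q) + 1) = a (2 * k + 1))"
  unfolding periodic_from_def all_nat_parity[of "\<lambda>n. n \<ge> 0 \<longrightarrow> a (n + 2 * q) = a n"]
  by (simp add: algebra_simps)

lemma periodic_from_1_even_iff:
  "periodic_from 1 (2 * q) a \<longleftrightarrow>
    (\<forall>k. a (2 * (k + q) + 1) = a (2 * k + 1) \<and> a (2 * (k + q) + 2) = a (2 * k + 2))"
proof -
  have "periodic_from 1 (2 * q) a \<longleftrightarrow> periodic_from 0 (2 * q) (\<lambda>n. a (Suc n))"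
  proof -
    have "(\<forall>n\<ge>1. P n) \<longleftrightarrow> (\<forall>n. P (Suc n))" for P :: "nat \<Rightarrow> bool"
      by (auto simp: Suc_le_eq gr0_conv_Suc)
    then show ?thesis unfolding periodic_from_def by simp
  qed
  then show ?thesis by (simp add: periodic_from_0_even_iff)
qed

lemma (in verblunsky_pair) periodic_iff_periodic:
  assumes anti: "\<And>k. c (2 * k + 2) = - c (2 * k + 1)"
  shows "periodic_from 0 (2 * q) \<alpha> \<longleftrightarrow> periodic_from 1 (2 * q) c \<and> periodic_from 1 (2 * q) m"
  unfolding periodic_from_0_even_iff periodic_from_1_even_iff block_eq_iff[OF anti] anti
  by auto

lemma periodic_from_0_mod:
  assumes "periodic_from 0 p a"
  shows "a (n mod p) = a n"
proof -
  have "a (r + p * j) = a r" for r j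
  proof (induction j)
    case (Suc j)
    have "a (r + p * Suc j) = a ((r + p * j) + p)" by (simp add: algebra_simps)
    then show ?case using assms Suc by (simp add: periodic_from_def)
  qed simp
  from this[of "n mod p" "n div p"] show ?thesis by simp
qed

theorem theorem4p2:
  fixes p :: nat and c d m :: "nat \<Rightarrow> real" and \<mu> :: "complex measure" and \<alpha> :: "nat \<Rightarrow> complex"
  assumes "even p" and "p \<ge> 2"
    and "positive_chain_sequence d"
    and "minimal_parameter_sequence d m"
    and "associated_measure c d \<mu>"
    and "\<alpha> = verblunsky \<mu>"
  shows "(periodic_from 1 p c \<and> periodic_from 1 p m \<and> (\<forall>n\<ge>1. c (2 * n) = - c (2 * n - 1)))
     \<longleftrightarrow>
     (periodic_from 0 p \<alpha> \<and>
      (\<forall>k\<in>{0..(p - 2) div 2}.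
         affine_parallel (line_through (\<alpha> (2 * k)) 1) (line_through (\<alpha> (2 * k + 1)) (-1))))"
proof -
  obtain q where p: "p = 2 * q" and q: "q > 0"
    using assms(1,2) by (auto elim!: evenE)
  obtain m' where m': "minimal_parameter_sequence d m'"
    and verb: "\<And>n. n \<ge> 1 \<Longrightarrow> verblunsky \<mu> (n - 1) = cnj (tau c (n - 1)) *
          ((1 - 2 * of_real (m' n) - \<i> * of_real (c n)) / (1 - \<i> * of_real (c n)))"
    using assms(5) unfolding associated_measure_def by blast
  have "m' = m"
    using minimal_parameter_sequence_unique[OF m' assms(4)] by blast
  interpret verblunsky_pair c m \<alpha>
  proof
    show "n \<ge> 1 \<Longrightarrow> 0 < m n \<and> m n < 1" for n
      using assms(4) unfolding minimal_parameter_sequence_def parameter_sequence_def by blast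
    show "\<alpha> n = cnj (tau c n) *
          ((1 - 2 * of_real (m (Suc n)) - \<i> * of_real (c (Suc n))) / (1 - \<i> * of_real (c (Suc n))))"
      for n
      using verb[of "Suc n"] by (simp add: assms(6) \<open>m' = m\<close>)
  qed
  let ?par = "\<lambda>k. affine_parallel (line_through (\<alpha> (2 * k)) 1) (line_through (\<alpha> (2 * k + 1)) (-1))"
  have anti: "(\<forall>n\<ge>1. c (2 * n) = - c (2 * n - 1)) \<longleftrightarrow> (\<forall>k. c (2 * k + 2) = - c (2 * k + 1))"
  proof (intro iffI allI impI)
    fix k assume "\<forall>n\<ge>1. c (2 * n) = - c (2 * n - 1)"
    from this[rule_format, of "Suc k"] show "c (2 * k + 2) = - c (2 * k + 1)" by simp
  next
    fix n :: nat assume *: "\<forall>k. c (2 * k + 2) = - c (2 * k + 1)" and "n \<ge> 1"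
    then obtain k where "n = Suc k" by (cases n) auto
    then show "c (2 * n) = - c (2 * n - 1)" using * by simp
  qed
  have one_period: "(\<forall>k\<in>{0..(p - 2) div 2}. ?par k) \<longleftrightarrow> (\<forall>k. ?par k)"
    if per: "periodic_from 0 p \<alpha>"
  proof
    assume par: "\<forall>k\<in>{0..(p - 2) div 2}. ?par k"
    show "\<forall>k. ?par k"
    proof
      fix k
      have "k mod q < q" using q by simp
      then have "k mod q \<in> {0..(p - 2) div 2}" by (auto simp: p)
      then have "?par (k mod q)" using par by blast
      moreover have "\<alpha> (2 * (k mod q)) = \<alpha> (2 * k)"
        using periodic_from_0_mod[OF per, of "2 * k"] by (simp add: p)
      moreover have "\<alpha> (2 * (k mod q) + 1) = \<alpha> (2 * k + 1)"
      proof -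
        have "(2 * k + 1) mod p = 2 * (k mod q) + 1"
          unfolding p by (simp add: mod_mult2_eq)
        then show ?thesis using periodic_from_0_mod[OF per, of "2 * k + 1"] by simp
      qed
      ultimately show "?par k" by simp
    qed
  qed blast
  have "periodic_from 0 p \<alpha> \<longleftrightarrow> periodic_from 1 p c \<and> periodic_from 1 p m"
    if "\<forall>k. c (2 * k + 2) = - c (2 * k + 1)"
    using periodic_iff_periodic[of q] that unfolding p by blast
  then show ?thesis
    using anti one_period all_parallel_iff_all_antisymmetric by blast
qed

end
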